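(* Let $\mathcal{P}$ be the set of integers $k\ge 2$ such that $T_k(x)=x^k+x+1$ is primitive over $\mathbb{F}_2$. For $k\in\mathcal{P}$, let $U_k$ be the rotation of the cyclic word $M_k$ (defined in the context) that starts with $0^k$, and let $V_k=U_k\,U_k[0..k-2]$. Then $\chi(V_k)/r(V_k)$ approaches $2$ as $k\to\infty$ within $\mathcal{P}$; that is, for every $\varepsilon>0$ there is $k_0$ such that $|\chi(V_k)/r(V_k)-2|<\varepsilon$ for all $k\in\mathcal{P}$ with $k\ge k_0$.
   Context: For $k\in\mathcal{P}$: define $F:\{0,1\}^k\to\{0,1\}^k$ by $F(x_0,\dots,x_{k-1})=(x_1,\dots,x_{k-1},x_0\oplus x_1)$ and let $F'$ agree with $F$ except $F'(0^k)=0^{k-1}1$ and $F'(10^{k-1})=0^k$; $F'$ is a single cycle on all $2^k$ states. Starting from any state $x_0$ with $x_{t+1}=F'(x_t)$, let $w$ be the cyclic word of length $2^k$ with $w[t]$ the first coordinate of $x_t$ (a binary de Bruijn cycle of order $k$); $M_k$ is obtained from $w$ by reversing and complementing every bit. Strings are $0$-indexed. $\$$ is an end-marker smaller than $0,1$, appended once. $r(V)$ is the number of runs (maximal blocks of one repeated symbol) of $\operatorname{BWT}(V\$)$, the last column of the matrix of lexicographically sorted cyclic rotations of $V\$$. For a string $v$, a substring $x$ (possibly empty) is right-maximal if $xa,xb$ are substrings for two distinct symbols $a\neq b$; these $xa$ are the right-extensions. A set $S$ of positions of $v$ is suffixient if every right-extension is a suffix of $v[0..j]$ for some $j\in S$.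 $\chi(V)$ is the minimum size of a suffixient set for $V\$$. *)

theory Defs
  imports Complex_Main "HOL-Computational_Algebra.Polynomial" "HOL-Library.Z2"
    "HOL-Library.List_Lexorder" "HOL-Library.Sublist"
begin

definition T :: "nat \<Rightarrow> bit poly" where
  "T k = monom 1 k + [:1, 1:]"

definition primitive_F2 :: "bit poly \<Rightarrow> bool" where
  "primitive_F2 p \<longleftrightarrow> irreducible p \<and>
     p dvd (monom 1 (2 ^ degree p - 1) - 1) \<and>
     (\<forall>n. 0 < n \<and> n < 2 ^ degree p - 1 \<longrightarrow> \<not> p dvd (monom 1 n - 1))"

definition Pset :: "nat set" where
  "Pset = {k. 2 \<le> k \<and> primitive_F2 (T k)}"

text \<open>States are bool lists of length k (True = 1).\<close>
definition Fmap :: "bool list \<Rightarrow> bool list" where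
  "Fmap xs = tl xs @ [hd xs \<noteq> hd (tl xs)]"

definition Fmap' :: "nat \<Rightarrow> bool list \<Rightarrow> bool list" where
  "Fmap' k xs =
     (if xs = replicate k False then replicate (k - 1) False @ [True]
      else if xs = True # replicate (k - 1) False then replicate k False
      else Fmap xs)"

text \<open>Starting state x_0 = 0^k (any start gives a rotation of the same cyclic word,
  and U_k below only depends on the cyclic word).\<close>
definition dB_word :: "nat \<Rightarrow> bool list" where
  "dB_word k = map (\<lambda>t. hd ((Fmap' k ^^ t) (replicate k False))) [0..<2 ^ k]"

definition M_word :: "nat \<Rightarrow> bool list" where
  "M_word k = rev (map Not (dB_word k))"

definition U_word :: "nat \<Rightarrow> bool list" where
  "U_word k = rotate (LEAST i. i < 2 ^ k \<and>
       (\<forall>j<k. M_word k ! ((i + j) mod 2 ^ k) = False)) (M_word k)"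

definition V_word :: "nat \<Rightarrow> bool list" where
  "V_word k = U_word k @ take (k - 1) (U_word k)"

text \<open>Symbols encoded as naturals: \$ = 0 < '0' = 1 < '1' = 2.\<close>
definition with_end :: "bool list \<Rightarrow> nat list" where
  "with_end V = map (\<lambda>b. if b then 2 else 1) V @ [0]"

definition BWT :: "nat list \<Rightarrow> nat list" where
  "BWT s = map last (sorted_list_of_set {rotate i s | i. i < length s})"

definition runs :: "'a list \<Rightarrow> nat" where
  "runs xs = length (remdups_adj xs)"

definition r_meas :: "bool list \<Rightarrow> nat" where
  "r_meas V = runs (BWT (with_end V))"

definition right_maximal :: "'a list \<Rightarrow> 'a list \<Rightarrow> bool" where
  "right_maximal v x \<longleftrightarrow> (\<exists>a b. a \<noteq> b \<and> sublist (x @ [a]) v \<and> sublist (x @ [b]) v)"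

definition right_extension :: "'a list \<Rightarrow> 'a list \<Rightarrow> bool" where
  "right_extension v y \<longleftrightarrow> (\<exists>x a. y = x @ [a] \<and> right_maximal v x \<and> sublist (x @ [a]) v)"

definition suffixient :: "'a list \<Rightarrow> nat set \<Rightarrow> bool" where
  "suffixient v S \<longleftrightarrow> S \<subseteq> {..<length v} \<and>
     (\<forall>y. right_extension v y \<longrightarrow> (\<exists>j\<in>S. suffix y (take (Suc j) v)))"

definition chi :: "bool list \<Rightarrow> nat" where
  "chi V = Min {card S | S. suffixient (with_end V) S}"

end

(* Let N = 2^k. Annihilating polynomials show that a nonzero state of the linear register F
   has no period below N - 1: a period n would make the irreducible T_k divide x^n - 1. So F' is
   a single cycle, V_k contains every k-bit word exactly once and both starts and ends with
   0^(k-1). The maximal right-extensions of V_k$ are therefore the k-bit words and 0^(k-1)$,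
   each of them with exactly one end position, and chi(V_k) = N + 1.

   The rotations of V_k$ in lexicographic order start with 0^j$ for j < k, followed by the k-bit
   words. After reversal and complementation the feedback rule says that the letter in front of
   a k-bit word is 1 iff its last two bits agree, apart from the extreme words. Along the k-bit
   words in lexicographic order this gives the pattern 1001 1001 1001 ..., so that
   r(V_k) = N/2 + O(1). *)

theory Submission
  imports Defs "HOL-Number_Theory.Cong"
begin

section \<open>Annihilators of linear recurrences\<close>

text \<open>Sequences as a module over polynomials: the variable acts as the shift, and the
  resulting sequence is read at \<open>t\<close>.\<close>

definition recurrence_op :: "'a::comm_ring_1 poly \<Rightarrow> (nat \<Rightarrow> 'a) \<Rightarrow> nat \<Rightarrow> 'a" where
  "recurrence_op p s t = (\<Sum>i\<le>degree p. coeff p i * s (t + i))"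

lemma recurrence_op_upto:
  assumes "degree p \<le> n"
  shows "recurrence_op p s t = (\<Sum>i\<le>n. coeff p i * s (t + i))"
  unfolding recurrence_op_def using assms
  by (intro sum.mono_neutral_left) (auto simp: coeff_eq_0)

lemma recurrence_op_0 [simp]: "recurrence_op 0 s t = 0"
  by (simp add: recurrence_op_def)

lemma recurrence_op_pCons: "recurrence_op (pCons a p) s t = a * s t + recurrence_op p s (Suc t)"
  by (subst recurrence_op_upto[OF degree_pCons_le], subst sum.atMost_Suc_shift)
     (simp add: recurrence_op_def)

lemma recurrence_op_add: "recurrence_op (p + q) s t = recurrence_op p s t + recurrence_op q s t"
proof -
  let ?n = "max (degree p) (degree q)"
  have "degree (p + q) \<le> ?n" by (rule degree_add_le_max)
  then show ?thesis
    by (simp add: recurrence_op_upto[of _ ?n] sum.distrib distrib_right)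
qed

lemma recurrence_op_smult: "recurrence_op (smult a p) s t = a * recurrence_op p s t"
  by (subst recurrence_op_upto[OF degree_smult_le])
     (simp add: recurrence_op_def sum_distrib_left mult.assoc)

lemma recurrence_op_diff: "recurrence_op (p - q) s t = recurrence_op p s t - recurrence_op q s t"
proof -
  have "recurrence_op ((p - q) + q) s t = recurrence_op (p - q) s t + recurrence_op q s t"
    by (rule recurrence_op_add)
  then show ?thesis by simp
qed

text \<open>\<open>pCons a p * q\<close> is \<open>smult a q\<close> plus the product of
  \<open>p * q\<close> with the variable. That product shifts the argument, so the induction runs
  over all \<open>t\<close>.\<close>

lemma recurrence_op_mult_annihilated:
  assumes "\<And>t. recurrence_op q s t = 0"
  shows "recurrence_op (p * q) s t = 0"
proof (induction p arbitrary: t)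
  case 0
  then show ?case by simp
next
  case (pCons a p)
  then show ?case
    by (simp add: recurrence_op_add recurrence_op_smult recurrence_op_pCons assms)
qed

lemma recurrence_op_monom: "recurrence_op (monom a n) s t = a * s (t + n)"
proof (induction n arbitrary: t)
  case 0
  then show ?case by (simp add: monom_0 recurrence_op_pCons)
next
  case (Suc n)
  then show ?case by (simp add: monom_Suc recurrence_op_pCons)
qed

text \<open>The polynomials annihilating a sequence form an ideal, which is principal.\<close>

lemma irreducible_annihilator_dvd:
  fixes p q :: "'a::field poly"
  assumes irr: "irreducible p"
    and p: "\<And>t. recurrence_op p s t = 0" and q: "\<And>t. recurrence_op q s t = 0"
    and s: "s t0 \<noteq> 0"
  shows "p dvd q"
proof -
  define A where "A m \<longleftrightarrow> m \<noteq> 0 \<and> (\<forall>t. recurrence_op m s t = 0)" for m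
  have "A p" using irr p by (auto simp: A_def)
  \<comment> \<open>A nonzero annihilator of least degree generates the ideal.\<close>
  then obtain m where m: "A m" and least: "\<And>r. A r \<Longrightarrow> degree m \<le> degree r"
    using ex_has_least_nat[of A p degree] by blast
  have dvd: "m dvd r" if r: "\<And>t. recurrence_op r s t = 0" for r
  proof (rule ccontr)
    assume "\<not> m dvd r"
    then have nz: "r mod m \<noteq> 0" by (simp add: mod_eq_0_iff_dvd)
    have "r mod m = r - (r div m) * m" by (simp add: minus_div_mult_eq_mod)
    then have "recurrence_op (r mod m) s t = 0" for t
      using m by (simp add: recurrence_op_diff r recurrence_op_mult_annihilated A_def)
    with nz have "A (r mod m)" by (simp add: A_def)
    then have "degree m \<le> degree (r mod m)" by (rule least)
    moreover have "degree (r mod m) < degree m"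
      using degree_mod_less'[of m r] m nz by (simp add: A_def)
    ultimately show False by simp
  qed
  obtain c where c: "p = m * c" using dvd[OF p] by blast
  \<comment> \<open>A constant annihilator would multiply \<open>s t0\<close> by a nonzero
    scalar.\<close>
  have "\<not> is_unit m"
  proof
    assume "is_unit m"
    then obtain a where a: "m = [:a:]" by (auto simp: is_unit_poly_iff)
    with m have "a \<noteq> 0" by (simp add: A_def)
    moreover have "recurrence_op m s t0 = 0" using m by (simp add: A_def)
    ultimately show False using s by (simp add: a recurrence_op_pCons)
  qed
  with irr c have "is_unit c" using irreducibleD by blast
  then have "p dvd m" using c by (simp add: mult_unit_dvd_iff)
  then show ?thesis using dvd[OF q] by (rule dvd_trans)
qed

section \<open>The shift registers F and F'\<close>

text \<open>A coordinate moves one place towards the front in each step. The bit entering at the end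
  is left free, so the lemma serves both \<open>Fmap\<close> and \<open>Fmap'\<close>.\<close>

lemma shift_register_nth:
  assumes len: "\<And>t. length (x t) = k" and shift: "\<And>t. butlast (x (Suc t)) = tl (x t)"
    and "j < k"
  shows "x t ! j = hd (x (t + j))"
  using \<open>j < k\<close>
proof (induction j arbitrary: t)
  case 0
  then show ?case using len[of t] by (cases "x t") auto
next
  case (Suc j)
  have "x t ! Suc j = tl (x t) ! j" using Suc.prems len[of t] by (simp add: nth_tl)
  also have "\<dots> = butlast (x (Suc t)) ! j" by (simp add: shift)
  also have "\<dots> = x (Suc t) ! j" using Suc.prems len[of "Suc t"] by (simp add: nth_butlast)
  also have "\<dots> = hd (x (t + Suc j))" using Suc by simp
  finally show ?case .
qed

lemma finite_bool_lists: "finite {x :: bool list. length x = k}"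
  using finite_lists_length_eq[of "UNIV :: bool set" k] by simp

lemma card_bool_lists: "card {x :: bool list. length x = k} = 2 ^ k"
  using card_lists_length_eq[of "UNIV :: bool set" k] by simp

lemma degree_T: "2 \<le> k \<Longrightarrow> degree (T k) = k"
  unfolding T_def by (subst degree_add_eq_left) (auto simp: degree_monom_eq)

lemma length_Fmap: "xs \<noteq> [] \<Longrightarrow> length (Fmap xs) = length xs"
  by (simp add: Fmap_def)

text \<open>The image shows all bits but the first, and the first is the exclusive or of the second
  bit and the appended one.\<close>

lemma Fmap_eqD:
  assumes "length xs = length ys" "2 \<le> length xs" "Fmap xs = Fmap ys"
  shows "xs = ys"
proof -
  obtain a b xs' where xs: "xs = a # b # xs'"
    using assms(2) by (cases xs; cases "tl xs") auto
  moreover obtain c d ys' where "ys = c # d # ys'"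
    using assms(1) unfolding xs by (cases ys; cases "tl ys") auto
  ultimately show ?thesis using assms(3) by (auto simp: Fmap_def)
qed

lemma Fmap_zero: "2 \<le> k \<Longrightarrow> Fmap (replicate k False) = replicate k False"
  by (cases k rule: nat.exhaust; cases "k - 1")
     (auto simp: Fmap_def replicate_append_same)

locale primitive_trinomial =
  fixes k :: nat
  assumes k_in: "k \<in> Pset"
begin

abbreviation "N \<equiv> (2::nat) ^ k"

lemma k2: "2 \<le> k" using k_in by (simp add: Pset_def)

lemma N4: "4 \<le> N"
  using power_increasing[OF k2, of "2::nat"] by simp

lemma T_irreducible: "irreducible (T k)"
  using k_in by (simp add: Pset_def primitive_F2_def)

lemma T_order: "0 < n \<Longrightarrow> n < N - 1 \<Longrightarrow> \<not> T k dvd (monom 1 n - 1)"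
  using k_in degree_T[OF k2] by (simp add: Pset_def primitive_F2_def)

lemma length_Fmap_pow: "length x = k \<Longrightarrow> length ((Fmap ^^ t) x) = k"
proof (induction t)
  case (Suc t)
  then show ?case using k2 by (subst funpow.simps, subst comp_apply, subst length_Fmap) auto
qed simp

lemma Fmap_pow_inj:
  assumes "length x = k" "length y = k" "(Fmap ^^ t) x = (Fmap ^^ t) y"
  shows "x = y"
  using assms(3)
proof (induction t)
  case (Suc t)
  have "(Fmap ^^ t) x = (Fmap ^^ t) y"
  proof (rule Fmap_eqD)
    show "Fmap ((Fmap ^^ t) x) = Fmap ((Fmap ^^ t) y)" using Suc.prems by simp
  qed (simp_all only: length_Fmap_pow assms(1,2) k2)
  then show ?case by (rule Suc.IH)
qed simp

lemma Fmap_pow_zero: "(Fmap ^^ t) (replicate k False) = replicate k False"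
  by (induction t) (auto simp: Fmap_zero k2)

text \<open>A period \<open>n\<close> would make \<open>x^n - 1\<close> annihilate the output
  sequence, which \<open>T k\<close> annihilates anyway by the feedback rule. Irreducibility then
  gives divisibility, against the order of \<open>T k\<close>.\<close>

lemma Fmap_no_short_period:
  assumes len: "length x = k" and nz: "x \<noteq> replicate k False"
    and n: "0 < n" "n < N - 1"
  shows "(Fmap ^^ n) x \<noteq> x"
proof
  assume per: "(Fmap ^^ n) x = x"
  define y where "y t = (Fmap ^^ t) x" for t
  have ylen: "length (y t) = k" for t by (simp add: y_def length_Fmap_pow len)
  have nth: "y t ! j = hd (y (t + j))" if "j < k" for t j
    by (rule shift_register_nth[OF ylen _ that]) (simp add: y_def Fmap_def)
  \<comment> \<open>The bit appended in the step from \<open>t\<close> to \<open>Suc t\<close> sits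
    at index \<open>k - 1\<close> and reaches the front at time \<open>t + k\<close>.\<close>
  have rec: "hd (y (t + k)) = (hd (y t) \<noteq> hd (y (Suc t)))" for t
  proof -
    have "hd (y (t + k)) = y (Suc t) ! (k - 1)" using nth[of "k - 1" "Suc t"] k2 by simp
    also have "\<dots> = (hd (y t) \<noteq> hd (tl (y t)))"
      using ylen[of t] k2 by (simp add: y_def Fmap_def nth_append)
    also have "hd (tl (y t)) = y t ! 1"
      using ylen[of t] k2 by (cases "y t"; cases "tl (y t)") auto
    finally show ?thesis using nth[of 1 t] k2 by simp
  qed
  \<comment> \<open>Over \<open>bit\<close> the exclusive or becomes addition and signs disappear,
    so \<open>rec\<close> is the recurrence of \<open>T k\<close>.\<close>
  define s :: "nat \<Rightarrow> bit" where "s t = of_bool (hd (y t))" for t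
  have "recurrence_op (T k) s t = 0" for t
    by (simp add: T_def recurrence_op_add recurrence_op_monom recurrence_op_pCons s_def rec)
  moreover have "recurrence_op (monom 1 n - 1) s t = 0" for t
  proof -
    have "y (t + n) = y t" by (simp add: y_def funpow_add per)
    then have "s (t + n) = s t" by (simp add: s_def)
    then show ?thesis
      by (simp add: recurrence_op_diff recurrence_op_monom one_pCons recurrence_op_pCons)
  qed
  moreover obtain j where "j < k" "x ! j"
    using nz len by (metis nth_equalityI length_replicate nth_replicate)
  then have "s j \<noteq> 0" using nth[of j 0] by (simp add: s_def y_def)
  ultimately have "T k dvd monom 1 n - 1"
    using irreducible_annihilator_dvd[OF T_irreducible] by blast
  with T_order[OF n] show False by blast
qed

section \<open>The orbit of the linear register on the nonzero states\<close>

definition e1 :: "bool list" where "e1 = replicate (k - 1) False @ [True]"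
definition e0 :: "bool list" where "e0 = True # replicate (k - 1) False"

lemma e0_length: "length e0 = k" and e1_length: "length e1 = k"
  using k2 by (auto simp: e0_def e1_def)

lemma e1_nz: "e1 \<noteq> replicate k False"
proof
  assume "e1 = replicate k False"
  then have "last e1 = last (replicate k False)" by (rule arg_cong)
  then show False using k2 by (simp add: e1_def)
qed

text \<open>This is the edge at which \<open>Fmap'\<close> cuts the cycle of \<open>Fmap\<close>
  open to insert the zero state between \<open>e0\<close> and \<open>e1\<close>.\<close>

lemma Fmap_e0: "Fmap e0 = e1"
  using k2 by (cases "k - 1") (auto simp: Fmap_def e0_def e1_def)

lemma Fmap_pow_e1_nz: "(Fmap ^^ t) e1 \<noteq> replicate k False"
  using Fmap_pow_inj[of e1 "replicate k False" t] e1_length e1_nz Fmap_pow_zero by auto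

text \<open>Cancelling the common iterate by injectivity turns a repetition into a period of
  \<open>e1\<close> below \<open>N - 1\<close>.\<close>

lemma Fmap_orbit_inj: "inj_on (\<lambda>t. (Fmap ^^ t) e1) {..<N - 1}"
proof -
  have "(Fmap ^^ i) e1 \<noteq> (Fmap ^^ j) e1" if "i < j" "j < N - 1" for i j
  proof
    assume eq: "(Fmap ^^ i) e1 = (Fmap ^^ j) e1"
    have "(Fmap ^^ j) e1 = (Fmap ^^ i) ((Fmap ^^ (j - i)) e1)"
      using \<open>i < j\<close> by (metis comp_apply funpow_add le_add_diff_inverse less_imp_le)
    with eq have "(Fmap ^^ i) e1 = (Fmap ^^ i) ((Fmap ^^ (j - i)) e1)" by (simp only:)
    then have "e1 = (Fmap ^^ (j - i)) e1"
      by (rule Fmap_pow_inj[OF e1_length length_Fmap_pow[OF e1_length]])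
    moreover have "(Fmap ^^ (j - i)) e1 \<noteq> e1"
      by (rule Fmap_no_short_period) (use that e1_length e1_nz in auto)
    ultimately show False by simp
  qed
  then show ?thesis by (intro linorder_inj_onI) auto
qed

text \<open>The orbit consists of \<open>N - 1\<close> distinct nonzero states, and there are no
  others.\<close>

lemma Fmap_orbit: "(\<lambda>t. (Fmap ^^ t) e1) ` {..<N - 1} = {x. length x = k} - {replicate k False}"
proof (rule card_subset_eq)
  show "finite ({x. length x = k} - {replicate k False})"
    using finite_bool_lists by simp
  show "(\<lambda>t. (Fmap ^^ t) e1) ` {..<N - 1} \<subseteq> {x. length x = k} - {replicate k False}"
    using length_Fmap_pow[OF e1_length] Fmap_pow_e1_nz by auto
  show "card ((\<lambda>t. (Fmap ^^ t) e1) ` {..<N - 1}) = card ({x. length x = k} - {replicate k False})"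
    by (simp only: card_image[OF Fmap_orbit_inj] card_lessThan)
       (simp add: card_Diff_singleton card_bool_lists)
qed

text \<open>The iterate lies in the orbit, say at index \<open>j\<close>; cancellation gives the
  period \<open>N - 1 - j\<close>, which is too short unless \<open>j = 0\<close>.\<close>

lemma Fmap_period: "(Fmap ^^ (N - 1)) e1 = e1"
proof -
  have "(Fmap ^^ (N - 1)) e1 \<in> (\<lambda>t. (Fmap ^^ t) e1) ` {..<N - 1}"
    unfolding Fmap_orbit using length_Fmap_pow[OF e1_length] Fmap_pow_e1_nz by auto
  then obtain j where j: "j < N - 1" "(Fmap ^^ (N - 1)) e1 = (Fmap ^^ j) e1" by auto
  have "(Fmap ^^ (N - 1)) e1 = (Fmap ^^ j) ((Fmap ^^ (N - 1 - j)) e1)"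
    using j(1) by (metis comp_apply funpow_add le_add_diff_inverse less_imp_le)
  with j(2) have "(Fmap ^^ j) e1 = (Fmap ^^ j) ((Fmap ^^ (N - 1 - j)) e1)" by (simp only:)
  then have *: "e1 = (Fmap ^^ (N - 1 - j)) e1"
    by (rule Fmap_pow_inj[OF e1_length length_Fmap_pow[OF e1_length]])
  have "j = 0"
  proof (rule ccontr)
    assume "j \<noteq> 0"
    then have "(Fmap ^^ (N - 1 - j)) e1 \<noteq> e1"
      by (intro Fmap_no_short_period) (use j(1) e1_length e1_nz in auto)
    with * show False by simp
  qed
  with j(2) show ?thesis by simp
qed

section \<open>The single cycle of the modified register\<close>

definition state :: "nat \<Rightarrow> bool list" where
  "state t = (Fmap' k ^^ t) (replicate k False)"

lemma state_0: "state 0 = replicate k False" by (simp add: state_def)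

lemma state_Suc_Fmap': "state (Suc t) = Fmap' k (state t)" by (simp add: state_def)

text \<open>\<open>Fmap'\<close> deviates from \<open>Fmap\<close> only at the zero state and at
  \<open>e0\<close>. The former is never reached from \<open>e1\<close> under \<open>Fmap\<close>,
  and meeting \<open>e0\<close> too early would return to \<open>e1\<close> too early.\<close>

lemma state_Suc: "t < N - 1 \<Longrightarrow> state (Suc t) = (Fmap ^^ t) e1"
proof (induction t)
  case 0
  then show ?case by (simp add: state_Suc_Fmap' state_0 Fmap'_def e1_def)
next
  case (Suc t)
  have ne: "(Fmap ^^ t) e1 \<noteq> e0"
  proof
    assume "(Fmap ^^ t) e1 = e0"
    then have "(Fmap ^^ Suc t) e1 = e1" using Fmap_e0 by simp
    moreover have "(Fmap ^^ Suc t) e1 \<noteq> e1"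
      by (rule Fmap_no_short_period) (use Suc.prems e1_length e1_nz in auto)
    ultimately show False by simp
  qed
  have "state (Suc (Suc t)) = Fmap' k ((Fmap ^^ t) e1)"
    using Suc by (simp add: state_Suc_Fmap'[of "Suc t"])
  also have "\<dots> = Fmap ((Fmap ^^ t) e1)"
    using ne Fmap_pow_e1_nz by (simp add: Fmap'_def e0_def)
  finally show ?case by simp
qed

text \<open>The last state of the orbit has the same image under \<open>Fmap\<close> as
  \<open>e0\<close>, hence equals \<open>e0\<close>, which \<open>Fmap'\<close> sends to
  zero.\<close>

lemma state_N: "state N = replicate k False"
proof -
  have "Fmap ((Fmap ^^ (N - 2)) e1) = (Fmap ^^ Suc (N - 2)) e1" by simp
  also have "Suc (N - 2) = N - 1" using N4 by linarith
  also have "(Fmap ^^ (N - 1)) e1 = Fmap e0" by (simp only: Fmap_period Fmap_e0)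
  finally have "Fmap ((Fmap ^^ (N - 2)) e1) = Fmap e0" .
  then have "(Fmap ^^ (N - 2)) e1 = e0"
    by (rule Fmap_eqD[rotated 2]) (simp_all only: k2 e0_length length_Fmap_pow[OF e1_length])
  moreover have "Suc (Suc (N - 2)) = N" "N - 2 < N - 1" using N4 by linarith+
  ultimately have "state N = Fmap' k e0"
    using state_Suc[of "N - 2"] state_Suc_Fmap'[of "Suc (N - 2)"] by simp
  also have "e0 \<noteq> replicate k False" unfolding e0_def using k2 by (cases k) auto
  then have "Fmap' k e0 = replicate k False" by (simp add: Fmap'_def e0_def)
  finally show ?thesis .
qed

lemma state_surj:
  assumes "length x = k"
  shows "\<exists>t<N. state t = x"
proof (cases "x = replicate k False")
  case True
  then show ?thesis using state_0 by (intro exI[of _ 0]) simp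
next
  case False
  with assms have "x \<in> (\<lambda>t. (Fmap ^^ t) e1) ` {..<N - 1}" by (simp only: Fmap_orbit) simp
  then obtain t where "t < N - 1" "x = (Fmap ^^ t) e1" by auto
  then show ?thesis using state_Suc by (intro exI[of _ "Suc t"]) auto
qed

lemma state_periodic: "state (t + N) = state t"
  by (induction t) (simp_all add: state_N state_0 state_Suc_Fmap')

lemma state_mod: "state (t mod N) = state t"
proof -
  have "state (r + q * N) = state r" for r q
  proof (induction q)
    case (Suc q)
    have "r + Suc q * N = (r + q * N) + N" by simp
    then show ?case by (simp only: state_periodic Suc.IH)
  qed simp
  from this[of "t mod N" "t div N"] show ?thesis by (simp only: mod_div_mult_eq)
qed

lemma length_state: "length (state t) = k"
proof -
  have "length (state (t mod N)) = k"
  proof (cases "t mod N")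
    case (Suc m)
    have "t mod N < N" by simp
    with Suc have "m < N - 1" by linarith
    then show ?thesis using Suc state_Suc[of m] length_Fmap_pow[OF e1_length] by simp
  qed (simp add: state_0)
  then show ?thesis by (simp add: state_mod)
qed

text \<open>The de Bruijn cycle extended periodically to all indices.\<close>

definition W :: "nat \<Rightarrow> bool" where "W t = hd (state t)"

lemma butlast_Fmap': "2 \<le> k \<Longrightarrow> butlast (Fmap' k xs) = tl xs"
  by (auto simp: Fmap'_def Fmap_def butlast_conv_take)

lemma state_nth: "j < k \<Longrightarrow> state t ! j = W (t + j)"
  unfolding W_def
  by (rule shift_register_nth[OF length_state]) (simp_all add: state_Suc_Fmap' butlast_Fmap' k2)

lemma W_mod: "W (t mod N) = W t"
  by (simp add: W_def state_mod)

text \<open>The two exceptional states of \<open>Fmap'\<close> share the zero tail, so a single 1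
  behind the first bit of the window excludes both.\<close>

lemma W_rec:
  assumes "j \<in> {1..<k}" "W (t + j)"
  shows "W (t + k) = (W t \<noteq> W (Suc t))"
proof -
  have tl: "tl (state t) \<noteq> replicate (k - 1) False"
  proof
    assume eq: "tl (state t) = replicate (k - 1) False"
    have "state t ! j = tl (state t) ! (j - 1)" using assms(1) length_state[of t] by (cases j) (auto simp: nth_tl)
    also have "\<dots> = replicate (k - 1) False ! (j - 1)" by (simp only: eq)
    also have "\<dots> = False" by (rule nth_replicate) (use assms(1) in auto)
    finally have "\<not> state t ! j" by simp
    then show False using assms state_nth by simp
  qed
  have "tl (replicate k False) = replicate (k - 1) False" by simp
  with tl have F: "state (Suc t) = Fmap (state t)" unfolding state_Suc_Fmap' Fmap'_def by auto
  have "W (t + k) = state (Suc t) ! (k - 1)" using state_nth[of "k - 1" "Suc t"] k2 by simp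
  also have "\<dots> = (hd (state t) \<noteq> hd (tl (state t)))"
    using length_state[of t] k2 by (simp add: F Fmap_def nth_append)
  also have "hd (tl (state t)) = state t ! 1"
    using length_state[of t] k2 by (cases "state t"; cases "tl (state t)") auto
  finally show ?thesis using state_nth[of 1 t] k2 by (simp add: W_def)
qed

section \<open>The reversed complement and its rotation\<close>

lemma length_M: "length (M_word k) = N"
  by (simp add: M_word_def dB_word_def)

lemma M_nth: "i < N \<Longrightarrow> M_word k ! i = (\<not> W (N - 1 - i))"
  by (simp add: M_word_def dB_word_def rev_nth W_def state_def)

text \<open>Reversal pairs indices whose sum is \<open>N - 1\<close>; stating this modulo
  \<open>N\<close> lets windows wrap around.\<close>

lemma M_W:
  assumes "(i + t) mod N = N - 1"
  shows "M_word k ! (i mod N) = (\<not> W t)"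
proof -
  let ?a = "N - 1 - i mod N"
  have lt: "i mod N < N" by simp
  then have a: "?a + i mod N = N - 1" by linarith
  have "(?a + i) mod N = (?a + i mod N) mod N" by (simp add: mod_add_right_eq)
  also have "\<dots> = N - 1" unfolding a using N4 by simp
  finally have "(t + i) mod N = (?a + i) mod N" using assms by (simp add: add.commute)
  then have "t mod N = ?a mod N"
    using cong_add_rcancel_nat[of t i ?a N] by (simp add: cong_def)
  then have "W t = W ?a" using W_mod[of t] W_mod[of ?a] by metis
  then show ?thesis using lt by (simp add: M_nth)
qed

lemma M_windows:
  assumes "length y = k"
  shows "\<exists>n<N. \<forall>j<k. M_word k ! ((n + j) mod N) = y ! j"
proof -
  have "length (rev (map Not y)) = k" using assms by simp
  from state_surj[OF this] obtain a where a: "a < N" "state a = rev (map Not y)" by blast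
  have kN: "k < N" by simp
  \<comment> \<open>With this start, position \<open>?m + j\<close> is paired with index
    \<open>a + (k - 1 - j)\<close>: their sum is \<open>2 * N - 1\<close>.\<close>
  let ?m = "2 * N - k - a"
  have "M_word k ! ((?m mod N + j) mod N) = y ! j" if "j < k" for j
  proof -
    have "?m + j + (a + (k - 1 - j)) = (N - 1) + N" using that a(1) kN by linarith
    then have "(?m + j + (a + (k - 1 - j))) mod N = (N - 1 + N) mod N" by (simp only:)
    also have "\<dots> = N - 1" unfolding mod_add_self2 using N4 by simp
    finally have "M_word k ! ((?m + j) mod N) = (\<not> W (a + (k - 1 - j)))" by (rule M_W)
    also have "W (a + (k - 1 - j)) = state a ! (k - 1 - j)" using that by (simp add: state_nth)
    also have "\<dots> = (\<not> y ! j)" using that assms by (simp add: a(2) rev_nth)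
    finally show ?thesis by (simp add: mod_add_left_eq)
  qed
  then show ?thesis by (intro exI[of _ "?m mod N"]) auto
qed

definition off :: nat where
  "off = (LEAST i. i < N \<and> (\<forall>j<k. M_word k ! ((i + j) mod N) = False))"

definition u :: "nat \<Rightarrow> bool" where
  "u i = M_word k ! ((off + i) mod N)"

lemma off: "off < N \<and> (\<forall>j<k. M_word k ! ((off + j) mod N) = False)"
  unfolding off_def
proof (rule LeastI_ex)
  show "\<exists>n. n < N \<and> (\<forall>j<k. M_word k ! ((n + j) mod N) = False)"
    using M_windows[of "replicate k False"] by auto
qed

lemma u_zero: "j < k \<Longrightarrow> \<not> u j"
  using off by (simp add: u_def)

lemma u_periodic: "u (i + N) = u i"
  by (simp add: u_def add.assoc[symmetric])

lemma u_windows: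
  assumes "length y = k"
  shows "\<exists>i<N. \<forall>j<k. u (i + j) = y ! j"
proof -
  obtain n where n: "n < N" "\<And>j. j < k \<Longrightarrow> M_word k ! ((n + j) mod N) = y ! j"
    using M_windows[OF assms] by blast
  \<comment> \<open>The summand \<open>N\<close> keeps the subtraction of \<open>off\<close> from
    truncating at zero.\<close>
  let ?i = "n + N - off"
  have "u (?i mod N + j) = y ! j" if "j < k" for j
  proof -
    have "(off + (?i mod N + j)) mod N = (?i mod N + (off + j)) mod N"
      by (simp add: ac_simps)
    also have "\<dots> = (?i + (off + j)) mod N" by (rule mod_add_left_eq)
    also have "?i + (off + j) = n + j + N" using off by linarith
    finally show ?thesis using n(2)[OF that] by (simp add: u_def)
  qed
  then show ?thesis by (intro exI[of _ "?i mod N"]) auto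
qed

text \<open>This is \<open>W_rec\<close> read backwards: the letter produced by the feedback now
  precedes its window, and the complement turns inequality into equality.\<close>

lemma u_rec:
  assumes "j \<in> {1..<k}" "\<not> u (i + j)"
  shows "u i = (u (i + (k - 1)) = u (i + k))"
proof -
  \<comment> \<open>The index of \<open>W\<close> paired with position \<open>i + k\<close> of
    \<open>u\<close>.\<close>
  let ?t = "N - 1 - (off + i + k) mod N"
  have *: "u (i + l) = (\<not> W (?t + m))" if "l + m = k" for l m
  proof -
    have "(off + i + k) mod N < N" by simp
    then have t: "(off + i + k) mod N + ?t = N - 1" by linarith
    have "off + (i + l) + (?t + m) = off + i + k + ?t" using that by simp
    then have "(off + (i + l) + (?t + m)) mod N = ((off + i + k) mod N + ?t) mod N"
      by (simp only: mod_add_left_eq)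
    also have "\<dots> = N - 1" unfolding t using N4 by simp
    finally show ?thesis unfolding u_def by (rule M_W)
  qed
  have "W (?t + (k - j))" using *[of j "k - j"] assms by auto
  then have "W (?t + k) = (W ?t \<noteq> W (Suc ?t))"
    by (rule W_rec[rotated]) (use assms in auto)
  then show ?thesis
    using *[of 0 k] *[of k 0] *[of "k - 1" 1] k2 by auto
qed

text \<open>The \<open>k - 1\<close> letters copied to the end are the next letters of the periodic
  extension.\<close>

lemma V_word_eq: "V_word k = map u [0..<N + k - 1]"
proof (rule nth_equalityI)
  have U: "U_word k = rotate off (M_word k)" by (simp add: U_word_def off_def)
  have lU: "length (U_word k) = N" by (simp add: U length_M)
  have kN: "k < N" by simp
  then have "min N (k - 1) = k - 1" by linarith
  then show len: "length (V_word k) = length (map u [0..<N + k - 1])"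
    using k2 by (simp add: V_word_def lU del: One_nat_def)
  have Un: "U_word k ! i = u i" if "i < N" for i
    using that by (simp add: U nth_rotate length_M u_def add.commute)
  fix i assume "i < length (V_word k)"
  then have i: "i < N + k - 1" by (simp add: len)
  have "V_word k ! i = u i"
  proof (cases "i < N")
    case True
    then show ?thesis by (simp add: V_word_def nth_append lU Un)
  next
    case False
    then have "i - N < N" using i kN by linarith
    then have "V_word k ! i = u (i - N)"
      using False i by (simp add: V_word_def nth_append lU Un)
    also have "\<dots> = u i" using u_periodic[of "i - N"] False by simp
    finally show ?thesis .
  qed
  then show "V_word k ! i = map u [0..<N + k - 1] ! i" using i by simp
qed

end

section \<open>Runs and ordered bit strings\<close>

text \<open>Cutting inside the run of \<open>y\<close>, with \<open>y\<close> kept on both sides,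
  counts that one run twice.\<close>

lemma runs_append_Cons: "runs (xs @ y # ys) + 1 = runs (xs @ [y]) + runs (y # ys)"
proof -
  have "length (remdups_adj (y # ys)) \<noteq> 0" by simp
  then show ?thesis unfolding runs_def remdups_adj_append[of xs y ys] length_append length_tl
    by linarith
qed

lemma runs_snoc: "runs (xs @ [y]) \<in> {runs xs..runs xs + 1}"
  unfolding runs_def by (cases xs rule: rev_cases) (auto simp: remdups_adj_append_two)

lemma runs_Cons_pos: "1 \<le> runs (y # ys)"
  using remdups_adj_length_ge1[of "y # ys"] by (simp add: runs_def)

lemma runs_append_le: "runs (xs @ ys) \<le> runs xs + runs ys"
proof (cases ys)
  case (Cons y zs)
  then show ?thesis using runs_append_Cons[of xs y zs] runs_snoc[of xs y] by auto
qed (simp add: runs_def)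

lemma runs_append_eq:
  assumes "xs \<noteq> []" "ys \<noteq> []" "last xs = hd ys"
  shows "runs (xs @ ys) = runs xs + runs ys - 1"
proof -
  obtain xs' x where xs: "xs = xs' @ [x]" using assms(1) by (cases xs rule: rev_cases) auto
  obtain ys' where ys: "ys = x # ys'" using assms xs by (cases ys) auto
  have "runs (x # x # ys') = runs (x # ys')" by (simp add: runs_def)
  then show ?thesis
    using runs_append_Cons[of xs' x "x # ys'"] by (simp add: xs ys)
qed

lemma runs_le_appendL: "runs xs \<le> runs (xs @ ys)"
proof (cases ys)
  case (Cons y zs)
  then show ?thesis
    using runs_append_Cons[of xs y zs] runs_snoc[of xs y] runs_Cons_pos[of y zs] by auto
qed simp

lemma runs_rev [simp]: "runs (rev xs) = runs xs"
  by (simp add: runs_def)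

lemma runs_le_appendR: "runs ys \<le> runs (xs @ ys)"
  using runs_le_appendL[of "rev ys" "rev xs"] by (simp flip: rev_append)

lemma runs_le_length: "runs xs \<le> length xs"
  by (simp add: runs_def)

lemma runs_map_inj: "inj f \<Longrightarrow> runs (map f xs) = runs xs"
  by (simp add: runs_def remdups_adj_map_injective)

lemma runs_replicate_le: "runs (replicate n x) \<le> 1"
  by (simp add: runs_def remdups_adj_replicate)

section \<open>Bit strings in lexicographic order\<close>

lemma list_less_append: "a < b \<Longrightarrow> c @ a # r < c @ b # (r' :: 'a::order list)"
  by (induction c) (auto simp: Cons_less_Cons)

fun bit_strings :: "nat \<Rightarrow> bool list list" where
  "bit_strings 0 = [[]]"
| "bit_strings (Suc k) = map (Cons False) (bit_strings k) @ map (Cons True) (bit_strings k)"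

lemma set_strs: "set (bit_strings k) = {y. length y = k}"
  by (induction k) (auto simp: image_iff length_Suc_conv)

text \<open>Comparison at the first differing bit. A proper prefix is not smaller here, so the
  relation survives the appending of arbitrary tails.\<close>

definition branch_less :: "bool list \<Rightarrow> bool list \<Rightarrow> bool" where
  "branch_less y z \<longleftrightarrow> (\<exists>c r r'. y = c @ False # r \<and> z = c @ True # r')"

lemma branch_less_Cons: "branch_less y z \<Longrightarrow> branch_less (b # y) (b # z)"
  unfolding branch_less_def by (metis append_Cons)

lemma branch_less_FT: "branch_less (False # y) (True # z)"
  unfolding branch_less_def by (metis append_Nil)

lemma bit_strings_sorted: "sorted_wrt branch_less (bit_strings k)"
proof (induction k)
  case (Suc k)
  have "sorted_wrt branch_less (map (Cons b) (bit_strings k))" for b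
    unfolding sorted_wrt_map using Suc.IH
    by (rule sorted_wrt_mono_rel[rotated]) (rule branch_less_Cons)
  then show ?case by (auto simp: sorted_wrt_append branch_less_FT)
qed simp

text \<open>Isolates the three strings whose preceding letter is not governed by the feedback
  rule.\<close>

lemma bit_strings_ends:
  "\<exists>mid. bit_strings (k + 2) = replicate (k + 2) False # mid @
     [replicate (k + 1) True @ [False], replicate (k + 2) True]"
proof (induction k)
  case 0
  then show ?case by (auto simp: numeral_2_eq_2)
next
  case (Suc k)
  then obtain mid where "bit_strings (k + 2) = replicate (k + 2) False # mid @
     [replicate (k + 1) True @ [False], replicate (k + 2) True]" by blast
  then show ?case by auto
qed

definition eq_last_two :: "bool list \<Rightarrow> bool" where
  "eq_last_two y \<longleftrightarrow> y ! (length y - 2) = y ! (length y - 1)"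

text \<open>A bit in front leaves the last two bits alone, so the pattern is doubled from one length
  to the next. It starts and ends with \<open>True\<close>, so one run is merged at the seam: 2
  (2^(k+1) + 1) - 1 = 2^(k+2) + 1.\<close>

lemma eq_last_two_strs:
  "runs (map eq_last_two (bit_strings (k + 2))) = 2 ^ (k + 1) + 1 \<and>
   hd (map eq_last_two (bit_strings (k + 2))) \<and> last (map eq_last_two (bit_strings (k + 2)))"
proof (induction k)
  case 0
  then show ?case by (simp add: numeral_2_eq_2 eq_last_two_def runs_def)
next
  case (Suc k)
  let ?L = "map eq_last_two (bit_strings (k + 2))"
  have len: "length y = k + 2" if "y \<in> set (bit_strings (k + 2))" for y
    using that unfolding set_strs by simp
  have "eq_last_two (b # y) = eq_last_two y" if "y \<in> set (bit_strings (k + 2))" for b y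
    using len[OF that] by (simp add: eq_last_two_def)
  then have "map eq_last_two (map (Cons b) (bit_strings (k + 2))) = ?L" for b by simp
  moreover have "bit_strings (Suc k + 2) = map (Cons False) (bit_strings (k + 2)) @ map (Cons True) (bit_strings (k + 2))"
    by simp
  ultimately have L: "map eq_last_two (bit_strings (Suc k + 2)) = ?L @ ?L"
    by (simp only: map_append)
  have "?L \<noteq> []" using bit_strings_ends[of k] by auto
  moreover have "last ?L = hd ?L" using Suc.IH by blast
  ultimately have "runs (?L @ ?L) = runs ?L + runs ?L - 1"
    by (intro runs_append_eq) auto
  with Suc.IH \<open>?L \<noteq> []\<close> show ?case unfolding L by simp
qed

section \<open>Suffixient sets\<close>

lemma suffix_same_length:
  "suffix y z \<Longrightarrow> suffix y' z \<Longrightarrow> length y = length y' \<Longrightarrow> y = y'"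
  by (auto simp: suffix_def)

abbreviation enc :: "bool list \<Rightarrow> nat list" where
  "enc \<equiv> map (\<lambda>b. if b then 2 else 1)"

lemma inj_code: "inj (\<lambda>b. if b then 2 else 1 :: nat)"
  by (rule injI) (simp split: if_splits)

lemma inj_enc: "inj enc"
  by (rule inj_mapI[OF inj_code])

text \<open>The combinatorial properties that determine \<open>chi\<close>; the feedback rule enters
  only with the Burrows-Wheeler transform.\<close>

locale de_Bruijn_word =
  fixes k :: nat and u :: "nat \<Rightarrow> bool"
  assumes k2: "2 \<le> k"
    and zero: "\<And>j. j < k \<Longrightarrow> \<not> u j"
    and periodic: "\<And>i. u (i + 2 ^ k) = u i"
    and windows: "\<And>y. length y = k \<Longrightarrow> \<exists>i<2 ^ k. \<forall>j<k. u (i + j) = y ! j"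
begin

abbreviation "N \<equiv> (2::nat) ^ k"

definition s :: "nat list" where "s = with_end (map u [0..<N + k - 1])"

lemma N4: "4 \<le> N"
  using power_increasing[OF k2, of "2::nat"] by simp

lemma length_s: "length s = N + k"
  using k2 by (simp add: s_def with_end_def)

lemma s_nth: "i < N + k - 1 \<Longrightarrow> s ! i = (if u i then 2 else 1)"
  by (simp add: s_def with_end_def nth_append)

lemma s_end: "s ! (N + k - 1) = 0"
  by (simp add: s_def with_end_def nth_append)

definition pos :: "bool list \<Rightarrow> nat" where
  "pos y = (SOME i. i < N \<and> (\<forall>j<k. u (i + j) = y ! j))"

lemma pos:
  assumes "length y = k"
  shows "pos y < N \<and> (\<forall>j<k. u (pos y + j) = y ! j)"
  unfolding pos_def by (rule someI_ex) (use windows[OF assms] in blast)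

lemma pos_inj: "inj_on pos {y. length y = k}"
proof (rule inj_onI)
  fix y z assume "y \<in> {y. length y = k}" "z \<in> {y. length y = k}" "pos y = pos z"
  then show "y = z" using pos[of y] pos[of z] by (intro nth_equalityI) auto
qed

text \<open>There are as many words as positions, so the injection \<open>pos\<close> is onto and
  every position below \<open>N\<close> starts exactly one chosen window.\<close>

lemma pos_image: "pos ` {y. length y = k} = {..<N}"
proof (rule card_subset_eq)
  show "pos ` {y. length y = k} \<subseteq> {..<N}" using pos by auto
  show "card (pos ` {y. length y = k}) = card {..<N}"
    by (simp add: card_image pos_inj card_bool_lists)
qed simp

lemma pos_eq_0:
  assumes "length y = k"
  shows "pos y = 0 \<longleftrightarrow> y = replicate k False"
proof -
  have *: "y = replicate k False" if "length y = k" "pos y = 0" for y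
    using pos[OF that(1)] that zero by (intro nth_equalityI) auto
  have "0 \<in> pos ` {y. length y = k}" using N4 by (simp add: pos_image)
  then obtain y0 where "length y0 = k" "pos y0 = 0" by auto
  then show ?thesis using * assms by metis
qed

lemma take_drop_s:
  assumes "i + l \<le> N + k - 1"
  shows "take l (drop i s) = enc (map (\<lambda>j. u (i + j)) [0..<l])"
proof (rule nth_equalityI)
  show "length (take l (drop i s)) = length (enc (map (\<lambda>j. u (i + j)) [0..<l]))"
    using assms by (simp add: length_s)
qed (use assms in \<open>simp add: length_s s_nth\<close>)

lemma window_s:
  assumes "length y = k"
  shows "take k (drop (pos y) s) = enc y"
proof -
  have "map (\<lambda>j. u (pos y + j)) [0..<k] = y"
    using pos[OF assms] assms by (intro nth_equalityI) auto
  moreover have "pos y + k \<le> N + k - 1" using pos[OF assms] by linarith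
  ultimately show ?thesis by (simp add: take_drop_s)
qed

text \<open>The last \<open>k - 1\<close> letters before the end-marker repeat the first ones, which
  are zeros.\<close>

lemma drop_s:
  assumes "j < k"
  shows "drop (N + k - 1 - j) s = enc (replicate j False) @ [0]"
proof (rule nth_equalityI)
  show len: "length (drop (N + k - 1 - j) s) = length (enc (replicate j False) @ [0])"
    using assms by (simp add: length_s)
  fix i assume "i < length (drop (N + k - 1 - j) s)"
  then have i: "i \<le> j" using assms by (simp add: length_s)
  have "drop (N + k - 1 - j) s ! i = s ! (N + k - 1 - j + i)"
    by (rule nth_drop) (simp add: length_s)
  also have "\<dots> = (enc (replicate j False) @ [0]) ! i"
  proof (cases "i = j")
    case True
    moreover have "N + k - 1 - j + j = N + k - 1" using assms by linarith
    ultimately show ?thesis using s_end by (simp add: nth_append)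
  next
    case False
    have "u (N + k - 1 - j + i) = u (k - 1 - j + i)"
      using periodic[of "k - 1 - j + i"] assms by (simp add: ac_simps)
    then have "\<not> u (N + k - 1 - j + i)" using zero[of "k - 1 - j + i"] assms i False by simp
    moreover have "N + k - 1 - j + i < N + k - 1" using assms i False by linarith
    ultimately show ?thesis using s_nth[of "N + k - 1 - j + i"] i False by (simp add: nth_append)
  qed
  finally show "drop (N + k - 1 - j) s ! i = (enc (replicate j False) @ [0]) ! i" .
qed

lemma sublist_enc:
  assumes "length y = k"
  shows "sublist (enc y) s"
  using window_s[OF assms] by (metis sublist_drop sublist_order.order.trans sublist_take)

text \<open>All words of length \<open>k\<close> occur, so the first \<open>k - 1\<close> letters
  are followed by either bit.\<close>

lemma right_extension_enc:
  assumes "length y = k"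
  shows "right_extension s (enc y)"
proof -
  obtain x b where y: "y = x @ [b]" using assms k2 by (cases y rule: rev_cases) auto
  have "sublist (enc (x @ [c])) s" for c by (rule sublist_enc) (use assms y in simp)
  from this[of True] this[of False] this[of b] show ?thesis
    unfolding right_extension_def right_maximal_def y
    by (intro exI[of _ "enc x"] exI[of _ "if b then 2 else 1"] conjI exI[of _ 1] exI[of _ 2]) simp_all
qed

lemma right_extension_end: "right_extension s (enc (replicate (k - 1) False) @ [0])"
proof -
  let ?x = "enc (replicate (k - 1) False)"
  have "sublist (?x @ [0]) s" using drop_s[of "k - 1"] k2 by (metis One_nat_def diff_less less_le_trans sublist_drop zero_less_numeral zero_less_one)
  moreover have "sublist (enc (replicate (k - 1) False @ [False])) s"
    by (rule sublist_enc) (use k2 in simp)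
  ultimately show ?thesis
    unfolding right_extension_def right_maximal_def
    by (intro exI[of _ ?x] exI[of _ 0] conjI exI[of _ 1]) simp_all
qed

text \<open>The \<open>N + 1\<close> right-extensions in \<open>?Y\<close> all have length
  \<open>k\<close>, and two different words of one length cannot end at the same position.\<close>

lemma card_suffixient_ge:
  assumes "suffixient s S"
  shows "N + 1 \<le> card S"
proof -
  let ?Y = "insert (enc (replicate (k - 1) False) @ [0]) (enc ` {y. length y = k})"
  have len: "length y = k" if "y \<in> ?Y" for y using that k2 by auto
  have inj: "inj_on enc {y. length y = k}"
    using inj_enc by (rule inj_on_subset) simp
  have "enc (replicate (k - 1) False) @ [0] \<notin> enc ` {y. length y = k}"
  proof
    assume "enc (replicate (k - 1) False) @ [0] \<in> enc ` {y. length y = k}"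
    then have "0 \<in> set (enc (replicate (k - 1) False) @ [0])" and
      "\<exists>y. enc (replicate (k - 1) False) @ [0] = enc y" by auto
    then obtain y where "0 \<in> set (enc y)" by metis
    then show False by (auto split: if_splits)
  qed
  then have card: "card ?Y = N + 1"
    by (simp add: card_image[OF inj] card_bool_lists finite_bool_lists)
  have "\<forall>y\<in>?Y. \<exists>j\<in>S. suffix y (take (Suc j) s)"
    using assms right_extension_enc right_extension_end unfolding suffixient_def by blast
  then obtain f where f: "\<And>y. y \<in> ?Y \<Longrightarrow> f y \<in> S \<and> suffix y (take (Suc (f y)) s)" by metis
  have "inj_on f ?Y"
    by (rule inj_onI) (metis f len suffix_same_length)
  moreover have "f ` ?Y \<subseteq> S" using f by blast
  moreover have "finite S" using assms finite_subset unfolding suffixient_def by blast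
  ultimately have "card ?Y \<le> card S" by (rule card_inj_on_le)
  with card show ?thesis by simp
qed

text \<open>An occurrence ending before position \<open>k - 1\<close> lies within the initial zeros,
  so the same word also ends at \<open>k - 1\<close>. The interval has \<open>N + 1\<close> elements
  and attains the lower bound.\<close>

lemma suffixient_tail: "suffixient s {k - 1..<N + k}"
  unfolding suffixient_def
proof (intro conjI allI impI)
  show "{k - 1..<N + k} \<subseteq> {..<length s}" by (auto simp: length_s)
  fix y assume "right_extension s y"
  then obtain x a where y: "y = x @ [a]" and sub: "sublist y s"
    unfolding right_extension_def by blast
  from sub obtain ps ss where s: "s = ps @ y @ ss" unfolding sublist_def by blast
  let ?j = "length ps + length x"
  have len: "length ps + length y \<le> N + k" using length_s unfolding s by simp
  show "\<exists>j\<in>{k - 1..<N + k}. suffix y (take (Suc j) s)"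
  proof (cases "k - 1 \<le> ?j")
    case True
    have "take (Suc ?j) s = ps @ y" unfolding s y by simp
    then have "suffix y (take (Suc ?j) s)" by (auto simp: suffix_def)
    then show ?thesis using True len y by (intro bexI[of _ ?j]) auto
  next
    case False
    have s1: "s ! m = 1" if "m < k" for m using that N4 zero by (subst s_nth) auto
    have "y = replicate (length y) 1"
    proof (rule nth_equalityI)
      fix i assume i: "i < length y"
      have "y ! i = s ! (length ps + i)" unfolding s using i by (simp add: nth_append)
      also have "\<dots> = 1" by (rule s1) (use False i y in simp)
      finally show "y ! i = replicate (length y) 1 ! i" using i by simp
    qed simp
    moreover have "take (Suc (k - 1)) s = replicate (k - length y + length y) 1"
      using False y k2 s1 by (intro nth_equalityI) (auto simp: length_s)
    ultimately have "suffix y (take (Suc (k - 1)) s)"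
      unfolding replicate_add by (metis suffixI)
    then show ?thesis using k2 by (intro bexI[of _ "k - 1"]) auto
  qed
qed

lemma chi_eq: "chi (map u [0..<N + k - 1]) = N + 1"
  unfolding chi_def s_def[symmetric]
proof (rule Min_eqI)
  have "{card S |S. suffixient s S} \<subseteq> card ` Pow {..<length s}"
    unfolding suffixient_def by auto
  then show "finite {card S |S. suffixient s S}" by (rule finite_subset) simp
  show "N + 1 \<le> c" if "c \<in> {card S |S. suffixient s S}" for c
    using that card_suffixient_ge by auto
  show "N + 1 \<in> {card S |S. suffixient s S}"
    using suffixient_tail k2 by (intro CollectI exI[of _ "{k - 1..<N + k}"]) auto
qed

end

section \<open>The Burrows-Wheeler transform\<close>

lemma sorted_list_of_set_eq:
  fixes xs :: "'a::linorder list"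
  assumes "sorted_wrt (<) xs" "set xs = A"
  shows "sorted_list_of_set A = xs"
  using assms by (metis strict_sorted_iff sorted_list_of_set.idem_if_sorted_distinct)

lemma last_rotate:
  assumes "i < length xs"
  shows "last (rotate i xs) = (if i = 0 then last xs else xs ! (i - 1))"
proof (cases "i = 0")
  case False
  moreover have "xs \<noteq> []" using assms by auto
  ultimately have "take i xs \<noteq> []" "last (take i xs) = xs ! (i - 1)"
    using assms by (auto simp: last_conv_nth min_def)
  then show ?thesis using assms False by (simp add: rotate_drop_take)
qed simp

text \<open>The new assumption determines the letter at \<open>i\<close> from the window of length
  \<open>k\<close> that starts at \<open>i + 1\<close>.\<close>

locale de_Bruijn_recurrence = de_Bruijn_word +
  assumes rec: "\<And>i j. j \<in> {1..<k} \<Longrightarrow> \<not> u (i + j) \<Longrightarrow> u i = (u (i + (k - 1)) = u (i + k))"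
begin

lemma rotate_s_end:
  assumes "j < k"
  shows "\<exists>r. rotate (N + k - 1 - j) s = enc (replicate j False) @ 0 # r"
proof -
  have "N + k - 1 - j < length s" using assms by (simp add: length_s)
  then have "rotate (N + k - 1 - j) s = drop (N + k - 1 - j) s @ take (N + k - 1 - j) s"
    by (simp only: rotate_drop_take mod_less)
  then show ?thesis unfolding drop_s[OF assms] by simp
qed

lemma rotate_s_pos:
  assumes "length y = k"
  shows "\<exists>r. rotate (pos y) s = enc y @ r"
proof -
  have "pos y < length s" using pos[OF assms] by (simp add: length_s)
  then have "rotate (pos y) s = drop (pos y) s @ take (pos y) s" by (simp add: rotate_drop_take)
  also have "drop (pos y) s = take k (drop (pos y) s) @ drop k (drop (pos y) s)"
    by (rule append_take_drop_id[symmetric])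
  finally show ?thesis unfolding window_s[OF assms] by auto
qed

text \<open>The rows of the sorted matrix, indexed by how they begin: first \<open>0^j$\<close> for
  increasing \<open>j\<close>, then the words of length \<open>k\<close>.\<close>

definition rotations :: "nat list list" where
  "rotations = map (\<lambda>j. rotate (N + k - 1 - j) s) [0..<k] @ map (\<lambda>y. rotate (pos y) s) (bit_strings k)"

lemma bit_strings_form:
  obtains mid where "bit_strings k = replicate k False # mid @
     [replicate (k - 1) True @ [False], replicate k True]"
proof -
  have "k - 2 + 2 = k" "k - 2 + 1 = k - 1" using k2 by auto
  with bit_strings_ends[of "k - 2"] that show thesis by metis
qed

lemma rotate_pos_less:
  assumes "length y = k" "length z = k" "branch_less y z"
  shows "rotate (pos y) s < rotate (pos z) s"
proof -
  obtain r r' where r: "rotate (pos y) s = enc y @ r" "rotate (pos z) s = enc z @ r'"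
    using rotate_s_pos assms by blast
  obtain c t t' where "y = c @ False # t" "z = c @ True # t'"
    using assms(3) unfolding branch_less_def by blast
  then show ?thesis unfolding r by (simp add: list_less_append)
qed

text \<open>After \<open>j\<close> common zeros the end-marker, coded 0, meets a zero bit, coded
  1.\<close>

lemma rotate_end_less:
  assumes "j < k" "replicate l False = replicate j False @ False # t"
    and r: "rotate i s = enc (replicate l False) @ r"
  shows "rotate (N + k - 1 - j) s < rotate i s"
proof -
  obtain r' where r': "rotate (N + k - 1 - j) s = enc (replicate j False) @ 0 # r'"
    using rotate_s_end[OF assms(1)] by blast
  have "rotate i s = enc (replicate j False) @ 1 # enc t @ r"
    unfolding r assms(2) by simp
  then show ?thesis unfolding r' by (simp only: list_less_append zero_less_one)
qed

lemma rotations_sorted: "sorted_wrt (<) rotations"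
  unfolding rotations_def sorted_wrt_append
proof (intro conjI ballI)
  have split: "replicate l False = replicate j False @ False # replicate (l - j - 1) False"
    if "j < l" for j l
  proof -
    have "l = j + Suc (l - j - 1)" using that by simp
    then show ?thesis by (metis replicate_Suc replicate_add)
  qed
  have "rotate (N + k - 1 - i) s < rotate (N + k - 1 - j) s" if ij: "i < j" "j < k" for i j
  proof -
    obtain r where r: "rotate (N + k - 1 - j) s = enc (replicate j False) @ 0 # r"
      using rotate_s_end[OF ij(2)] by blast
    show ?thesis by (rule rotate_end_less[OF _ split[OF ij(1)] r]) (use ij in simp)
  qed
  then show "sorted_wrt (<) (map (\<lambda>j. rotate (N + k - 1 - j) s) [0..<k])"
    by (simp add: sorted_wrt_iff_nth_less)
  have len: "length y = k" if "y \<in> set (bit_strings k)" for y using that by (simp add: set_strs)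
  show "sorted_wrt (<) (map (\<lambda>y. rotate (pos y) s) (bit_strings k))"
    unfolding sorted_wrt_map
    by (rule sorted_wrt_mono_rel[OF _ bit_strings_sorted]) (rule rotate_pos_less[OF len len])
  fix a b assume "a \<in> set (map (\<lambda>j. rotate (N + k - 1 - j) s) [0..<k])"
    and "b \<in> set (map (\<lambda>y. rotate (pos y) s) (bit_strings k))"
  then obtain j y where j: "j < k" "a = rotate (N + k - 1 - j) s"
    and y: "y \<in> set (bit_strings k)" "b = rotate (pos y) s" by auto
  let ?z = "replicate k False"
  obtain r where r: "rotate (pos ?z) s = enc ?z @ r" using rotate_s_pos[of ?z] by auto
  have 1: "a < rotate (pos ?z) s"
    unfolding j(2) by (rule rotate_end_less[OF j(1) split[OF j(1)] r])
  obtain mid where mid: "bit_strings k = replicate k False # mid @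
     [replicate (k - 1) True @ [False], replicate k True]" by (rule bit_strings_form)
  \<comment> \<open>The zero word heads the sorted list, so it suffices to compare \<open>a\<close>
    with its rotation.\<close>
  have "y = ?z \<or> branch_less ?z y"
    using bit_strings_sorted[of k] y(1) unfolding mid sorted_wrt.simps set_simps(2) by blast
  then have "rotate (pos ?z) s \<le> b"
    unfolding y(2) using rotate_pos_less[of ?z y] len[OF y(1)] by auto
  with 1 show "a < b" by (rule less_le_trans)
qed

text \<open>The first block starts at the positions from \<open>N\<close> to
  \<open>N + k - 1\<close>, the second at those below \<open>N\<close>.\<close>

lemma set_rotations: "set rotations = {rotate i s |i. i < length s}"
proof -
  have "set rotations = (\<lambda>i. rotate i s) ` ((\<lambda>j. N + k - 1 - j) ` {..<k} \<union> pos ` {y. length y = k})"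
    unfolding rotations_def by (auto simp: set_strs)
  also have "(\<lambda>j. N + k - 1 - j) ` {..<k} = {N..<N + k}"
  proof
    show "{N..<N + k} \<subseteq> (\<lambda>j. N + k - 1 - j) ` {..<k}"
    proof
      fix i assume "i \<in> {N..<N + k}"
      then show "i \<in> (\<lambda>j. N + k - 1 - j) ` {..<k}"
        by (intro image_eqI[of _ _ "N + k - 1 - i"]) auto
    qed
  qed auto
  also have "{N..<N + k} \<union> pos ` {y. length y = k} = {..<length s}"
    unfolding pos_image length_s by auto
  finally show ?thesis by auto
qed

lemma BWT_s: "BWT s = map last rotations"
  unfolding BWT_def sorted_list_of_set_eq[OF rotations_sorted set_rotations] ..

section \<open>The letters of the transform and the number of its runs\<close>

lemma last_rotate_end:
  assumes "j < k - 1"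
  shows "last (rotate (N + k - 1 - j) s) = 1"
proof -
  let ?i = "N + (k - 2 - j)"
  have i: "N + k - 1 - j = Suc ?i" using assms by linarith
  have "?i < N + k - 1" using assms by linarith
  moreover have "\<not> u ?i"
    using periodic[of "k - 2 - j"] zero[of "k - 2 - j"] assms by (simp add: add.commute)
  moreover have "Suc ?i < length s" unfolding length_s using assms by linarith
  ultimately show ?thesis unfolding i by (subst last_rotate) (simp_all add: s_nth)
qed

text \<open>The zero word is excluded because the end-marker precedes it. A zero among the first
  \<open>k - 1\<close> letters makes the feedback rule applicable one position before the
  window.\<close>

lemma last_rotate_pos:
  assumes "length y = k" "y \<noteq> replicate k False" "take (k - 1) y \<noteq> replicate (k - 1) True"
  shows "last (rotate (pos y) s) = (if eq_last_two y then 2 else 1)"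
proof -
  have p0: "pos y \<noteq> 0" using assms by (simp add: pos_eq_0)
  have p: "pos y < N" "\<And>j. j < k \<Longrightarrow> u (pos y + j) = y ! j" using pos[OF assms(1)] by auto
  let ?i = "pos y - 1"
  have "\<exists>j<k - 1. \<not> y ! j"
  proof (rule ccontr)
    assume "\<not> ?thesis"
    then have "take (k - 1) y = replicate (k - 1) True"
      using assms(1) by (intro nth_equalityI) auto
    with assms(3) show False by contradiction
  qed
  then obtain j where j: "j < k - 1" "\<not> y ! j" by blast
  have nth: "u (?i + Suc l) = y ! l" if "l < k" for l using p(2)[OF that] p0 by simp
  have "u ?i = (u (?i + (k - 1)) = u (?i + k))"
    by (rule rec[of "Suc j"]) (use j nth[of j] in auto)
  moreover have "u (?i + (k - 1)) = y ! (k - 2)" "u (?i + k) = y ! (k - 1)"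
    using nth[of "k - 2"] nth[of "k - 1"] k2 by (simp_all add: Suc_diff_le numeral_2_eq_2 Suc_diff_Suc)
  ultimately have "u ?i = eq_last_two y" by (simp add: eq_last_two_def assms(1))
  moreover have "pos y < length s" "?i < N + k - 1" unfolding length_s using p(1) p0 by linarith+
  ultimately show ?thesis using p0 by (simp add: last_rotate s_nth)
qed

text \<open>The letters in front of the words in \<open>mid\<close> follow
  \<open>eq_last_two\<close> exactly; the remaining words and the rotations starting with
  \<open>0^j$\<close> change the number of runs by a bounded amount only.\<close>

lemma r_bounds:
  "2 ^ (k - 1) \<le> r_meas (map u [0..<N + k - 1]) + 2"
  "r_meas (map u [0..<N + k - 1]) \<le> 2 ^ (k - 1) + 6"
proof -
  obtain mid where mid: "bit_strings k = replicate k False # mid @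
     [replicate (k - 1) True @ [False], replicate k True]" by (rule bit_strings_form)
  let ?l = "\<lambda>y. last (rotate (pos y) s)"
  let ?e = "map eq_last_two"
  let ?A = "map (\<lambda>j. last (rotate (N + k - 1 - j) s)) [0..<k]"
  have "k = Suc (k - 1)" using k2 by simp
  then have "[0..<k] = [0..<k - 1] @ [k - 1]" by (metis upt_Suc_append zero_le)
  moreover have "map (\<lambda>j. last (rotate (N + k - 1 - j) s)) [0..<k - 1] = replicate (k - 1) 1"
    using last_rotate_end by (intro nth_equalityI) simp_all
  ultimately have A: "?A = replicate (k - 1) 1 @ [last (rotate (N + k - 1 - (k - 1)) s)]"
    by (simp only: map_append list.map)
  \<comment> \<open>A block of equal letters and one further letter, whose value is left
    open.\<close>
  have "runs ?A \<le> 2"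
    unfolding A using runs_append_le runs_replicate_le runs_le_length
    by (metis (no_types, lifting) add_mono_thms_linordered_semiring(1) le_trans length_Cons list.size(3) one_add_one One_nat_def)
  have "map ?l mid = map (\<lambda>b. if b then 2 else 1) (?e mid)"
  proof -
    have "distinct (bit_strings k)"
      using rotations_sorted by (simp add: strict_sorted_iff rotations_def distinct_map)
    have "?l y = (if eq_last_two y then 2 else 1)" if "y \<in> set mid" for y
    proof (rule last_rotate_pos)
      have "y \<in> set (bit_strings k)" using that unfolding mid by simp
      then show len: "length y = k" by (simp add: set_strs)
      show "y \<noteq> replicate k False" using that \<open>distinct (bit_strings k)\<close> unfolding mid by auto
      show "take (k - 1) y \<noteq> replicate (k - 1) True"
      proof
        \<comment> \<open>Such a word would be one of the last two strings of the list, which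
          \<open>mid\<close> does not contain by distinctness.\<close>
        assume eq: "take (k - 1) y = replicate (k - 1) True"
        have "y = take (k - 1) y @ [y ! (k - 1)]"
          using len k2 take_Suc_conv_app_nth[of "k - 1" y] by simp
        then have "y = replicate (k - 1) True @ [False] \<or> y = replicate (k - 1) True @ [True]"
          unfolding eq by (metis (full_types))
        moreover have "replicate (k - 1) True @ [True] = replicate k True"
          using \<open>k = Suc (k - 1)\<close> by (metis replicate_Suc replicate_append_same)
        ultimately show False using that \<open>distinct (bit_strings k)\<close> unfolding mid by auto
      qed
    qed
    then show ?thesis by simp
  qed
  then have mid_runs: "runs (map ?l mid) = runs (?e mid)"
    by (simp only: runs_map_inj[OF inj_code])
  have "k - 2 + 2 = k" "k - 2 + 1 = k - 1" using k2 by auto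
  then have L: "runs (?e (bit_strings k)) = 2 ^ (k - 1) + 1" using eq_last_two_strs[of "k - 2"] by simp
  obtain a b c where e: "?e (bit_strings k) = [a] @ ?e mid @ [b, c]" unfolding mid by simp
  have "runs ([a] @ ?e mid @ [b, c]) \<le> 1 + (runs (?e mid) + 2)"
    using runs_append_le[of "[a]" "?e mid @ [b, c]"] runs_append_le[of "?e mid" "[b, c]"]
      runs_le_length[of "[a]"] runs_le_length[of "[b, c]"] by simp
  moreover have "runs (?e mid) \<le> runs ([a] @ ?e mid @ [b, c])"
    by (meson le_trans runs_le_appendL runs_le_appendR)
  \<comment> \<open>Removing the three outer entries loses at most three of the 2^(k-1) + 1
    runs.\<close>
  ultimately have mid_bounds: "2 ^ (k - 1) \<le> runs (?e mid) + 2" "runs (?e mid) \<le> 2 ^ (k - 1) + 1"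
    unfolding e[symmetric] L by simp_all
  obtain a' b' c' where "map last rotations = ?A @ [a'] @ map ?l mid @ [b', c']"
    unfolding rotations_def mid by (simp add: comp_def)
  then have r: "r_meas (map u [0..<N + k - 1]) = runs (?A @ [a'] @ map ?l mid @ [b', c'])"
    by (simp only: r_meas_def s_def[symmetric] BWT_s)
  have "runs (map ?l mid) \<le> runs (?A @ [a'] @ map ?l mid @ [b', c'])"
    by (meson le_trans runs_le_appendL runs_le_appendR)
  with mid_bounds(1) show "2 ^ (k - 1) \<le> r_meas (map u [0..<N + k - 1]) + 2"
    unfolding r mid_runs by linarith
  have "runs (?A @ [a'] @ map ?l mid @ [b', c']) \<le> 2 + (1 + (runs (map ?l mid) + 2))"
    using runs_append_le[of ?A "[a'] @ map ?l mid @ [b', c']"]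
      runs_append_le[of "[a']" "map ?l mid @ [b', c']"] runs_append_le[of "map ?l mid" "[b', c']"]
      runs_le_length[of "[a']"] runs_le_length[of "[b', c']"] \<open>runs ?A \<le> 2\<close>
    by (simp only: list.size)
  with mid_bounds(2) show "r_meas (map u [0..<N + k - 1]) \<le> 2 ^ (k - 1) + 6"
    unfolding r mid_runs by linarith
qed

end

text \<open>Here \<open>M\<close> stands for 2^(k-1). The difference \<open>c - 2 * r\<close> is
  bounded by 11 in absolute value, while \<open>r\<close> exceeds
  \<open>15 / \<epsilon>\<close>.\<close>

lemma ratio_close:
  fixes c r :: real
  assumes "\<epsilon> > 0" "M > 2 + 15 / \<epsilon>" "M \<le> r + 2" "r \<le> M + 6" "c = 2 * M + 1"
  shows "\<bar>c / r - 2\<bar> < \<epsilon>"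
proof -
  have "M - 2 > 15 / \<epsilon>" "15 / \<epsilon> > 0" using assms by auto
  then have r: "r > 15 / \<epsilon>" "r > 0" using assms by linarith+
  then have "15 < \<epsilon> * r" using assms(1) by (simp add: field_simps)
  moreover have "\<bar>c - 2 * r\<bar> \<le> 11" using assms by linarith
  ultimately have "\<bar>c - 2 * r\<bar> < \<epsilon> * r" by linarith
  moreover have "c / r - 2 = (c - 2 * r) / r" using r by (simp add: field_simps)
  ultimately show ?thesis using r by (simp add: abs_divide divide_less_eq)
qed

theorem theorem3:
  shows "\<forall>\<epsilon>>0. \<exists>k0. \<forall>k\<in>Pset. k \<ge> k0 \<longrightarrow>
           \<bar>real (chi (V_word k)) / real (r_meas (V_word k)) - 2\<bar> < \<epsilon>"
proof (intro allI impI)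
  fix \<epsilon> :: real assume \<epsilon>: "\<epsilon> > 0"
  \<comment> \<open>The threshold \<open>m + 1\<close> for \<open>k\<close> makes 2^(k-1) at least
    2^m, as \<open>ratio_close\<close> demands.\<close>
  obtain m where m: "2 + 15 / \<epsilon> < 2 ^ m" using real_arch_pow[of 2 "2 + 15 / \<epsilon>"] by auto
  have "\<bar>real (chi (V_word k)) / real (r_meas (V_word k)) - 2\<bar> < \<epsilon>"
    if k: "k \<in> Pset" "m + 1 \<le> k" for k
  proof (rule ratio_close[OF \<epsilon>])
    interpret P: primitive_trinomial k by unfold_locales (rule k(1))
    interpret B: de_Bruijn_recurrence k P.u
      by unfold_locales (fact P.k2 P.u_zero P.u_periodic P.u_windows P.u_rec)+
    have "(2::real) ^ m \<le> 2 ^ (k - 1)" by (rule power_increasing) (use k in auto)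
    with m show "2 + 15 / \<epsilon> < 2 ^ (k - 1)" by linarith
    have "real (2 ^ (k - 1)) \<le> real (r_meas (V_word k) + 2)"
      using B.r_bounds(1) unfolding P.V_word_eq by (rule of_nat_mono)
    then show "2 ^ (k - 1) \<le> real (r_meas (V_word k)) + 2" by simp
    have "real (r_meas (V_word k)) \<le> real (2 ^ (k - 1) + 6)"
      using B.r_bounds(2) unfolding P.V_word_eq by (rule of_nat_mono)
    then show "real (r_meas (V_word k)) \<le> 2 ^ (k - 1) + 6" by simp
    have "2 ^ k = 2 * (2::real) ^ (k - 1)" using k(2) by (cases k) auto
    then show "real (chi (V_word k)) = 2 * 2 ^ (k - 1) + 1"
      unfolding P.V_word_eq B.chi_eq by simp
  qed
  then show "\<exists>k0. \<forall>k\<in>Pset. k \<ge> k0 \<longrightarrow>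
      \<bar>real (chi (V_word k)) / real (r_meas (V_word k)) - 2\<bar> < \<epsilon>" by blast
qed

end
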